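(* For any $\delta>0$, there is no deterministic truthful mechanism in the Euclidean plane that is $(2-\delta)$-consistent and $(1+\sqrt{2}-\delta)$-robust, even if it is provided with full predictions $\hat{\mathbf{x}}$ (a predicted location for each agent).
   Context: Facility location in the plane. There are $n$ agents with location profile $\mathbf{x}=\langle x_1,\dots,x_n\rangle\in(\mathbb{R}^2)^n$; $d$ is the Euclidean distance. A full prediction is $\hat{\mathbf{x}}=\langle\hat x_1,\dots,\hat x_n\rangle\in(\mathbb{R}^2)^n$; it is accurate for $\mathbf{x}$ if $\hat{\mathbf{x}}=\mathbf{x}$. A deterministic mechanism $f$ assigns to every number of agents $n$, every profile $\mathbf{x}$ and every prediction $\hat{\mathbf{x}}$ a facility location $f(\mathbf{x},\hat{\mathbf{x}})\in\mathbb{R}^2$. Standing assumptions on mechanisms: unanimous (if all $x_i$ equal a common point $p$, the facility is at $p$); anonymous (for a fixed prediction, the outcome is unchanged when the reported locations are permuted among the agents); scale-independent (multiplying all coordinates of reported and predicted locations by the same $\lambda>0$ multiplies the facility location by $\lambda$). Truthful: for every $\hat{\mathbf{x}}$, every $\mathbf{x}$, every agent $i$ and every $x_i'\in\mathbb{R}^2$, $d(x_i,f(\mathbf{x},\hat{\mathbf{x}}))\le d(x_i,f((\mathbf{x}_{-i},x_i'),\hat{\mathbf{x}}))$, where $(\mathbf{x}_{-i},x_i')$ is $\mathbf{x}$ with $x_i$ replaced by $x_i'$. Egalitarian social cost of a location $y$: $C(y,\mathbf{x})=\max_i d(x_i,y)$; the optimal location $o(\mathbf{x})$ minimizes it over $y\in\mathbb{R}^2$.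 The mechanism is $\alpha$-consistent if $C(f(\mathbf{x},\hat{\mathbf{x}}),\mathbf{x})\le\alpha\,C(o(\mathbf{x}),\mathbf{x})$ for all $\mathbf{x}$ and all $\hat{\mathbf{x}}$ accurate for $\mathbf{x}$; it is $\beta$-robust if $C(f(\mathbf{x},\hat{\mathbf{x}}),\mathbf{x})\le\beta\,C(o(\mathbf{x}),\mathbf{x})$ for all $\mathbf{x}$ and all $\hat{\mathbf{x}}$. *)

theory Defs
  imports "HOL-Analysis.Analysis" "HOL-Combinatorics.Combinatorics"
begin

type_synonym point = "real ^ 2"

text \<open>
  A profile of \<open>n\<close> agents is a list of length \<open>n\<close>, agent \<open>i\<close> being at position
  \<open>xs ! i\<close>. In \<open>f xs ps\<close> the first argument of a mechanism is the reported profile and the second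
  the prediction. Since a mechanism is a total function on lists, its values on the empty
  profile and on lists of different lengths are meaningless; every property below is therefore
  restricted to valid instances.
\<close>

type_synonym profile = "point list"
type_synonym mechanism = "profile \<Rightarrow> profile \<Rightarrow> point"

definition instance_ok :: "profile \<Rightarrow> profile \<Rightarrow> bool" where
  "instance_ok xs ps \<longleftrightarrow> 1 \<le> length xs \<and> length ps = length xs"

definition unanimous :: "mechanism \<Rightarrow> bool" where
  "unanimous f \<longleftrightarrow>
     (\<forall>xs ps p. instance_ok xs ps \<longrightarrow> (\<forall>i<length xs. xs ! i = p) \<longrightarrow> f xs ps = p)"

definition anonymous :: "mechanism \<Rightarrow> bool" where
  "anonymous f \<longleftrightarrow>
     (\<forall>xs ps \<sigma>. instance_ok xs ps \<longrightarrow> \<sigma> permutes {..<length xs} \<longrightarrow>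
        f (permute_list \<sigma> xs) ps = f xs ps)"

definition scale_independent :: "mechanism \<Rightarrow> bool" where
  "scale_independent f \<longleftrightarrow>
     (\<forall>xs ps. \<forall>c>0. instance_ok xs ps \<longrightarrow>
        f (map (\<lambda>x. c *\<^sub>R x) xs) (map (\<lambda>x. c *\<^sub>R x) ps) = c *\<^sub>R f xs ps)"

definition truthful :: "mechanism \<Rightarrow> bool" where
  "truthful f \<longleftrightarrow>
     (\<forall>ps xs. instance_ok xs ps \<longrightarrow>
        (\<forall>i<length xs. \<forall>x'. dist (xs ! i) (f xs ps) \<le> dist (xs ! i) (f (xs[i := x']) ps)))"

definition egal_cost :: "point \<Rightarrow> profile \<Rightarrow> real" where
  "egal_cost y xs = (MAX i\<in>{..<length xs}. dist (xs ! i) y)"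

definition opt_loc :: "profile \<Rightarrow> point" where
  "opt_loc xs = (ARG_MIN (\<lambda>y. egal_cost y xs) y. True)"

definition accurate :: "profile \<Rightarrow> profile \<Rightarrow> bool" where
  "accurate ps xs \<longleftrightarrow> ps = xs"

definition consistent :: "real \<Rightarrow> mechanism \<Rightarrow> bool" where
  "consistent \<alpha> f \<longleftrightarrow>
     (\<forall>xs ps. instance_ok xs ps \<longrightarrow> accurate ps xs \<longrightarrow>
        egal_cost (f xs ps) xs \<le> \<alpha> * egal_cost (opt_loc xs) xs)"

definition robust :: "real \<Rightarrow> mechanism \<Rightarrow> bool" where
  "robust \<beta> f \<longleftrightarrow>
     (\<forall>xs ps. instance_ok xs ps \<longrightarrow>
        egal_cost (f xs ps) xs \<le> \<beta> * egal_cost (opt_loc xs) xs)"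

text \<open>The minimum is attained, so \<^const>\<open>opt_loc\<close> does pick a minimizer.\<close>

lemma continuous_on_egal_cost:
  assumes "xs \<noteq> []"
  shows "continuous_on S (\<lambda>y. egal_cost y xs)"
proof -
  have "continuous_on S (\<lambda>y. MAX i\<in>I. dist (xs ! i) y)" if "finite I" "I \<noteq> {}" for I
    using that
  proof (induction I rule: finite_ne_induct)
    case (singleton i)
    then show ?case by (simp add: continuous_intros)
  next
    case (insert i I)
    then show ?case by (simp add: continuous_intros continuous_on_max)
  qed
  from this[of "{..<length xs}"] show ?thesis
    using assms by (auto simp: egal_cost_def lessThan_empty_iff)
qed

lemma egal_cost_opt_loc_le:
  assumes "xs \<noteq> []"
  shows "egal_cost (opt_loc xs) xs \<le> egal_cost y xs"
proof -
  let ?C = "\<lambda>y. egal_cost y xs"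
  let ?a = "xs ! 0"
  have ge: "dist ?a y \<le> ?C y" for y
    unfolding egal_cost_def using assms by (intro Max_ge) auto
  have "0 \<le> ?C ?a" using ge[of ?a] by simp
  then have ne: "cball ?a (?C ?a) \<noteq> {}" by simp
  obtain z where z: "\<And>y. y \<in> cball ?a (?C ?a) \<Longrightarrow> ?C z \<le> ?C y"
    using continuous_attains_inf[OF compact_cball ne continuous_on_egal_cost[OF assms]] by blast
  have min: "?C z \<le> ?C y" for y
  proof (cases "y \<in> cball ?a (?C ?a)")
    case True
    then show ?thesis by (rule z)
  next
    case False
    then have "?C ?a \<le> ?C y" using ge[of y] by simp
    moreover have "?C z \<le> ?C ?a" using z[of ?a] \<open>0 \<le> ?C ?a\<close> by simp
    ultimately show ?thesis by simp
  qed
  then have "is_arg_min ?C (\<lambda>_. True) z" by (auto simp: is_arg_min_def not_less)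
  then have "is_arg_min ?C (\<lambda>_. True) (opt_loc xs)"
    unfolding opt_loc_def arg_min_def by (rule someI)
  then show ?thesis by (auto simp: is_arg_min_def not_less)
qed

end

theory Submission
  imports Defs
begin

text \<open>
  Fix the prediction in which \<open>n - 1\<close> agents, \<open>n\<close> even, sit at \<open>a\<close> and one sits at \<open>b\<close>. Let
  \<open>O\<^sub>k(x)\<close> be the set of outcomes when \<open>k\<close> agents report \<open>x\<close> and the others report a common point;
  these sets shrink as \<open>k\<close> grows, and the outcome at peaks \<open>x, y\<close> is a point of \<open>O\<^sub>k(x)\<close> nearest to \<open>y\<close>.
  Consistency below 2 forces \<open>O\<^bsub>n-1\<^esub>(a)\<close> to contain some \<open>b' \<noteq> a\<close>. Exchanging the two halves of the
  agents shows that the points of \<open>O\<^bsub>n/2\<^esub>(a)\<close> are seen from \<open>a\<close> under angles of at most 90 degrees, so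
  the sets \<open>O\<^sub>k(a)\<close>, \<open>n/2 \<le> k < n\<close>, span at \<open>a\<close> nested angles around the direction of \<open>b'\<close>. For
  large \<open>n\<close>, two consecutive angles nearly agree: some \<open>D \<in> O\<^bsub>k+1\<^esub>(a)\<close> lies almost on a supporting
  line of \<open>O\<^sub>k(a)\<close> through \<open>a\<close>. Choosing \<open>y\<close> with \<open>y - D\<close> normal to that line and as long as
  \<open>a - D\<close>, the outcome at peaks \<open>a, y\<close> is nearly \<open>D\<close>, whether \<open>k\<close> or \<open>k + 1\<close> agents are at \<open>a\<close>.
  Now contract towards \<open>D\<close> all agents but one, whose peak moves from \<open>a\<close> to \<open>y\<close>; the outcome
  stays near \<open>D\<close> at both ends, so at the midpoint it is at least about \<open>dist a y / 2\<close> away from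
  that agent, while the contraction can be chosen to make this nearly \<open>1 + sqrt 2\<close> times the
  radius of a disc containing all agents.
\<close>

section \<open>Points caught between two nearly tangent discs\<close>

text \<open>For \<open>t = 0\<close> and \<open>c < 1\<close> the disc about
  \<open>c *\<^sub>R w\<close> through the origin lies inside the disc about \<open>w\<close>
  through the origin and touches its boundary only there, which forces \<open>v = 0\<close>. In
  general, adding \<open>c\<close> times the first squared bound to the second cancels
  \<open>w \<bullet> v\<close>.\<close>

lemma crescent:
  fixes v w :: "'a::real_inner"
  assumes far: "norm w - t \<le> norm (w - v)" and near: "norm (c *\<^sub>R w - v) \<le> c * norm w + t"
    and c: "0 \<le> c" "c \<le> 1" and t: "0 \<le> t"
  shows "(1 - c) * (norm v)\<^sup>2 \<le> 4 * c * t * norm w + t\<^sup>2"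
proof -
  have "(norm w)\<^sup>2 - 2 * t * norm w \<le> (norm (w - v))\<^sup>2"
  proof (cases "t \<le> norm w")
    case True
    then have "(norm w - t)\<^sup>2 \<le> (norm (w - v))\<^sup>2"
      using far by (intro power_mono) auto
    moreover have "(norm w - t)\<^sup>2 = (norm w)\<^sup>2 - 2 * t * norm w + t\<^sup>2"
      by (simp add: power2_eq_square algebra_simps)
    ultimately show ?thesis by (smt (verit) zero_le_power2)
  next
    case False
    then have "norm w * (norm w - 2 * t) \<le> 0" using t by (intro mult_nonneg_nonpos) auto
    then show ?thesis by (smt (verit) power2_eq_square right_diff_distrib mult.assoc mult.commute zero_le_power2)
  qed
  also have "(norm (w - v))\<^sup>2 = (norm w)\<^sup>2 - 2 * (w \<bullet> v) + (norm v)\<^sup>2"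
    by (simp add: power2_norm_eq_inner inner_diff inner_commute)
  finally have 1: "0 \<le> c * (2 * t * norm w - 2 * (w \<bullet> v) + (norm v)\<^sup>2)"
    using c by (intro mult_nonneg_nonneg) auto
  have "(norm (c *\<^sub>R w - v))\<^sup>2 \<le> (c * norm w + t)\<^sup>2"
    using near by (intro power_mono) auto
  moreover have "(norm (c *\<^sub>R w - v))\<^sup>2 = c\<^sup>2 * (norm w)\<^sup>2 - 2 * c * (w \<bullet> v) + (norm v)\<^sup>2"
    unfolding power2_norm_eq_inner
    by (simp add: inner_diff inner_commute power2_eq_square algebra_simps)
  moreover have "(c * norm w + t)\<^sup>2 = c\<^sup>2 * (norm w)\<^sup>2 + 2 * c * t * norm w + t\<^sup>2"
    by (simp add: power2_eq_square algebra_simps)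
  ultimately show ?thesis using 1 by (simp add: algebra_simps)
qed

text \<open>Used when peaks move from \<open>x\<close> part of the way to \<open>P\<close> and
  truthfulness is known only up to an error \<open>t\<close>: the new outcome \<open>q\<close> is
  then displaced from \<open>P\<close> by order \<open>sqrt t\<close>.\<close>

lemma crescent_dist:
  fixes x P q :: "'a::real_inner"
  assumes "dist x P - t \<le> dist x q" "dist (P + c *\<^sub>R (x - P)) q \<le> c * dist x P + t"
    and c: "0 \<le> c" "c \<le> 1/2" and t: "0 \<le> t"
  shows "(dist q P)\<^sup>2 \<le> 4 * t * dist x P + 2 * t\<^sup>2"
proof -
  have "norm (x - P) - t \<le> norm ((x - P) - (q - P))"
    "norm (c *\<^sub>R (x - P) - (q - P)) \<le> c * norm (x - P) + t"
    using assms(1,2) by (simp_all add: dist_norm diff_diff_eq2 add.commute)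
  from crescent[OF this] have "(1 - c) * (dist q P)\<^sup>2 \<le> c * (4 * t * dist x P) + t\<^sup>2"
    using c t by (simp add: dist_norm mult_ac)
  also have "\<dots> \<le> 1/2 * (4 * t * dist x P) + t\<^sup>2"
    using c t by (intro add_right_mono mult_right_mono) auto
  finally have "(1 - c) * (dist q P)\<^sup>2 \<le> 1/2 * (4 * t * dist x P) + t\<^sup>2" .
  moreover have "1/2 * (dist q P)\<^sup>2 \<le> (1 - c) * (dist q P)\<^sup>2"
    using c by (intro mult_right_mono) auto
  ultimately show ?thesis by simp
qed

section \<open>Truthful rules on multisets and their option sets\<close>

text \<open>Anonymity is built in by letting the rule act on multisets; the prediction is fixed and
  absorbed into \<open>G\<close>.\<close>

locale truthful_rule =
  fixes G :: "'a::real_inner multiset \<Rightarrow> 'a" and n :: nat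
  assumes unan: "G (replicate_mset n p) = p"
    and sp: "size X + 1 = n \<Longrightarrow> dist x (G (add_mset x X)) \<le> dist x (G (add_mset x' X))"
begin

text \<open>The agents switch one at a time, and every comparison is made from the same peak
  \<open>x\<close>, so the inequalities chain.\<close>

lemma coalition_sp:
  "j + size R = n \<Longrightarrow> dist x (G (replicate_mset j x + R)) \<le> dist x (G (replicate_mset j x' + R))"
proof (induction j arbitrary: R)
  case (Suc j)
  have "dist x (G (replicate_mset j x + add_mset x R)) \<le> dist x (G (replicate_mset j x' + add_mset x R))"
    using Suc.prems by (intro Suc.IH) auto
  also have "\<dots> \<le> dist x (G (add_mset x' (replicate_mset j x' + R)))"
    using sp[of "replicate_mset j x' + R" x x'] Suc.prems by simp
  finally show ?case by simp
qed simp

text \<open>Truthfulness between the old and the new peak, in both directions, gives the hypotheses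
  of \<open>crescent\<close> with \<open>t = 0\<close>, so the outcome cannot move. For
  \<open>c = 1\<close> the peaks themselves do not move.\<close>

lemma move_toward:
  assumes "j + size R = n" and q: "G (replicate_mset j x + R) = q" and c: "0 \<le> c" "c \<le> 1"
  shows "G (replicate_mset j (q + c *\<^sub>R (x - q)) + R) = q"
proof (cases "c = 1")
  case False
  let ?x = "q + c *\<^sub>R (x - q)"
  let ?q = "G (replicate_mset j ?x + R)"
  have "dist x q \<le> dist x ?q" "dist ?x ?q \<le> dist ?x q"
    using coalition_sp[OF assms(1), of x ?x] coalition_sp[OF assms(1), of ?x x] q by auto
  moreover have "dist ?x ?q = norm (c *\<^sub>R (x - q) - (?q - q))" "dist ?x q = c * norm (x - q)"
    using c by (simp_all add: dist_norm diff_diff_eq2 add.commute)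
  ultimately have "norm (x - q) - 0 \<le> norm ((x - q) - (?q - q))"
    "norm (c *\<^sub>R (x - q) - (?q - q)) \<le> c * norm (x - q) + 0"
    using c by (simp_all add: dist_norm)
  from crescent[OF this c] have "(1 - c) * (norm (?q - q))\<^sup>2 \<le> 0" by simp
  then show ?thesis using False c by (simp add: mult_le_0_iff)
qed (use q in simp)

definition two_cluster :: "nat \<Rightarrow> 'a \<Rightarrow> 'a \<Rightarrow> 'a" where
  "two_cluster k x y = G (replicate_mset k x + replicate_mset (n - k) y)"

text \<open>Encoded as the fixed points of \<open>two_cluster k x\<close>; by
  \<open>two_cluster_in_option_set\<close> these are exactly its values.\<close>

definition option_set :: "nat \<Rightarrow> 'a \<Rightarrow> 'a set" where
  "option_set k x = {y. two_cluster k x y = y}"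

lemma two_cluster_same: "k \<le> n \<Longrightarrow> two_cluster k x x = x"
proof -
  assume "k \<le> n"
  then have "replicate_mset k x + replicate_mset (n - k) x = replicate_mset n x"
    by (simp add: multiset_eq_iff)
  then show ?thesis by (simp add: two_cluster_def unan)
qed

lemma two_cluster_sp1: "k \<le> n \<Longrightarrow> dist x (two_cluster k x y) \<le> dist x (two_cluster k x' y)"
  unfolding two_cluster_def by (rule coalition_sp) auto

lemma two_cluster_sp2: "k \<le> n \<Longrightarrow> dist y (two_cluster k x y) \<le> dist y (two_cluster k x y')"
  unfolding two_cluster_def
  using coalition_sp[of "n - k" "replicate_mset k x" y y'] by (simp add: add.commute)

lemma two_cluster_move1:
  assumes "k \<le> n" "two_cluster k x y = q" "0 \<le> c" "c \<le> 1"
  shows "two_cluster k (q + c *\<^sub>R (x - q)) y = q"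
  using assms unfolding two_cluster_def by (intro move_toward) auto

lemma two_cluster_move2:
  assumes "k \<le> n" "two_cluster k x y = q" "0 \<le> c" "c \<le> 1"
  shows "two_cluster k x (q + c *\<^sub>R (y - q)) = q"
  using assms move_toward[of "n - k" "replicate_mset k x" y q c]
  unfolding two_cluster_def by (simp add: add.commute)

lemma two_cluster_in_option_set: "k \<le> n \<Longrightarrow> two_cluster k x y \<in> option_set k x"
  using two_cluster_move2[of k x y _ 0] by (auto simp: option_set_def)

lemma two_cluster_nearest:
  assumes "k \<le> n" "r \<in> option_set k x"
  shows "dist y (two_cluster k x y) \<le> dist y r"
  using two_cluster_sp2[OF assms(1), of y x r] assms(2) by (simp add: option_set_def)

text \<open>One of the agents at \<open>x\<close> may go all the way to the outcome \<open>q\<close>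
  without changing it (\<open>c = 0\<close>), which leaves \<open>k\<close> agents at
  \<open>x\<close> and the rest at \<open>q\<close>.\<close>

lemma option_set_Suc_subset:
  assumes "Suc k \<le> n"
  shows "option_set (Suc k) x \<subseteq> option_set k x"
proof
  fix q assume "q \<in> option_set (Suc k) x"
  then have "G (replicate_mset 1 x + (replicate_mset k x + replicate_mset (n - Suc k) q)) = q"
    by (simp add: option_set_def two_cluster_def)
  from move_toward[OF _ this, of 0] assms
  have "G (add_mset q (replicate_mset k x + replicate_mset (n - Suc k) q)) = q" by simp
  moreover have "add_mset q (replicate_mset k x + replicate_mset (n - Suc k) q)
      = replicate_mset k x + replicate_mset (n - k) q"
    using assms by (simp add: Suc_diff_Suc flip: replicate_mset_Suc union_mset_add_mset_right)
  ultimately show "q \<in> option_set k x" by (simp add: option_set_def two_cluster_def)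
qed

lemma option_set_antimono:
  assumes "k \<le> l" "l \<le> n"
  shows "option_set l x \<subseteq> option_set k x"
  using assms by (induction l rule: dec_induct) (use option_set_Suc_subset in fastforce)+

text \<open>The second cluster can slide along the segment to a point \<open>?y\<close> near the
  outcome \<open>q\<close> without changing it. The first cluster could then join it and obtain
  \<open>?y\<close> by unanimity, so \<open>?y\<close> is no nearer to \<open>x\<close> than
  \<open>q\<close>; letting \<open>?y\<close> tend to \<open>q\<close> shows that the angle at
  \<open>q\<close> is not acute.\<close>

lemma two_cluster_angle:
  assumes k: "k \<le> n"
  shows "(x - two_cluster k x y) \<bullet> (y - two_cluster k x y) \<le> 0"
proof -
  define q where "q = two_cluster k x y"
  have ineq: "2 * ((x - q) \<bullet> (y - q)) \<le> c * (norm (y - q))\<^sup>2" if c: "0 < c" "c \<le> 1" for c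
  proof -
    let ?y = "q + c *\<^sub>R (y - q)"
    have "dist x (two_cluster k x ?y) \<le> dist x (two_cluster k ?y ?y)"
      using k by (rule two_cluster_sp1)
    then have "norm (x - q) \<le> norm ((x - q) - c *\<^sub>R (y - q))"
      using two_cluster_move2[OF k, of x y q c] c k two_cluster_same[OF k]
      by (simp add: q_def dist_norm algebra_simps)
    then have "(norm (x - q))\<^sup>2 \<le> (norm ((x - q) - c *\<^sub>R (y - q)))\<^sup>2"
      by (intro power_mono) auto
    also have "\<dots> = (norm (x - q))\<^sup>2 - c * (2 * ((x - q) \<bullet> (y - q)) - c * (norm (y - q))\<^sup>2)"
    proof -
      have "(norm (u - c *\<^sub>R v))\<^sup>2 = (norm u)\<^sup>2 - c * (2 * (u \<bullet> v) - c * (norm v)\<^sup>2)" for u v :: 'a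
        unfolding power2_norm_eq_inner by (simp add: inner_diff inner_commute algebra_simps)
      then show ?thesis .
    qed
    finally show ?thesis using c by (simp add: mult_le_0_iff)
  qed
  have "((\<lambda>c. c * (norm (y - q))\<^sup>2) \<longlongrightarrow> 0 * (norm (y - q))\<^sup>2) (at_right 0)"
    by (intro tendsto_intros)
  moreover have "\<forall>\<^sub>F c in at_right 0. 2 * ((x - q) \<bullet> (y - q)) \<le> c * (norm (y - q))\<^sup>2"
    using eventually_at_right_less[of 0] eventually_at_right_real[of 0 1]
    by (auto elim!: eventually_mono intro!: ineq)
  ultimately have "2 * ((x - q) \<bullet> (y - q)) \<le> 0 * (norm (y - q))\<^sup>2"
    by (rule tendsto_lowerbound) auto
  then show ?thesis by (simp add: q_def)
qed

text \<open>
  The peaks \<open>c\<close> with outcome \<open>x\<close> form a cone with apex \<open>x\<close>, although no convexity of the option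
  set is known: scaling such a peak by \<open>3/2\<close> to \<open>c'\<close>, the outcome \<open>w\<close> is at least as far from \<open>c\<close>
  as \<open>x\<close> is, while the angle at \<open>w\<close> between \<open>x\<close> and \<open>c'\<close> is not acute, which forces \<open>w = x\<close>.
\<close>
lemma two_cluster_stretch:
  assumes k: "k \<le> n" and c: "two_cluster k x (x + u) = x"
  shows "two_cluster k x (x + (3/2) *\<^sub>R u) = x"
proof -
  define w where "w = two_cluster k x (x + (3/2) *\<^sub>R u) - x"
  have "dist (x + u) x \<le> dist (x + u) (x + w)"
    using two_cluster_nearest[OF k two_cluster_in_option_set[OF k], of "x + u" x "x + (3/2) *\<^sub>R u"]
    by (simp add: c w_def)
  then have "(norm u)\<^sup>2 \<le> (norm (u - w))\<^sup>2" by (intro power_mono) (auto simp: dist_norm)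
  then have 1: "2 * (u \<bullet> w) \<le> w \<bullet> w"
    unfolding power2_norm_eq_inner by (simp add: inner_diff inner_commute)
  have "(- w) \<bullet> ((3/2) *\<^sub>R u - w) \<le> 0"
    using two_cluster_angle[OF k, of x "x + (3/2) *\<^sub>R u"] by (simp add: w_def algebra_simps)
  then have 2: "w \<bullet> w \<le> 3/2 * (u \<bullet> w)" by (simp add: inner_diff inner_commute)
  from 1 2 have "w \<bullet> w \<le> 0" by linarith
  then have "w = 0" by (metis inner_ge_zero inner_eq_zero_iff antisym)
  then show ?thesis by (simp add: w_def)
qed

text \<open>By iterated stretching, peaks arbitrarily far out on the ray from \<open>x\<close>
  through \<open>c\<close> keep the outcome \<open>x\<close>. The open discs about them with
  \<open>x\<close> on the boundary contain no option, and they exhaust an open half-space.\<close>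

lemma option_set_halfspace:
  assumes k: "k \<le> n" and c: "two_cluster k x c = x" and r: "r \<in> option_set k x"
  shows "(c - x) \<bullet> (r - x) \<le> 0"
proof (rule ccontr)
  assume neg: "\<not> ?thesis"
  define u v where "u = c - x" and "v = r - x"
  have *: "two_cluster k x (x + (3/2) ^ i *\<^sub>R u) = x" for i
  proof (induction i)
    case (Suc i)
    from two_cluster_stretch[OF k this] show ?case by simp
  qed (use c in \<open>simp add: u_def\<close>)
  have "2 * (3/2) ^ i * (u \<bullet> v) \<le> v \<bullet> v" for i :: nat
  proof -
    let ?t = "(3/2::real) ^ i"
    have "dist (x + ?t *\<^sub>R u) x \<le> dist (x + ?t *\<^sub>R u) (x + v)"
      using two_cluster_nearest[OF k r, of "x + ?t *\<^sub>R u"] * by (simp add: v_def)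
    then have "(norm (?t *\<^sub>R u))\<^sup>2 \<le> (norm (?t *\<^sub>R u - v))\<^sup>2"
      by (intro power_mono) (auto simp: dist_norm)
    then show ?thesis
      unfolding power2_norm_eq_inner by (simp add: inner_diff inner_commute mult_ac)
  qed
  moreover have "0 < u \<bullet> v" using neg by (simp add: u_def v_def)
  ultimately have "(3/2) ^ i \<le> (v \<bullet> v) / (2 * (u \<bullet> v))" for i
    by (simp add: field_simps)
  moreover obtain i where "(v \<bullet> v) / (2 * (u \<bullet> v)) < (3/2::real) ^ i"
    using real_arch_pow[of "3/2"] by auto
  ultimately show False by (meson not_le)
qed

section \<open>Moving one agent between two contracted clusters\<close>

text \<open>
  Contracting by \<open>1 - sqrt (1/2)\<close> puts the two contracted clusters and the midpoint agent on
  one circle, of radius \<open>1 - sqrt (1/2)\<close> times \<open>norm z\<close>. The parameters \<open>\<tau>\<close>, \<open>\<sigma>\<close>, \<open>\<theta>\<close> bound the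
  successive displacements of the outcome relative to \<open>norm z\<close>.
\<close>
lemma ratio_bound:
  assumes k: "Suc k \<le> n" and z: "a + z \<in> option_set (Suc k) a" "z \<noteq> 0"
    and \<nu>: "norm \<nu> = 1" "\<nu> \<bullet> z = 0"
    and wedge: "\<And>r. r \<in> option_set k a \<Longrightarrow> \<nu> \<bullet> (r - a) \<le> \<kappa> * norm (r - a)"
    and pos: "0 \<le> \<kappa>" "0 \<le> \<tau>" "0 \<le> \<sigma>" "0 \<le> \<theta>" "\<theta> \<le> 1"
    and small: "6 * \<kappa> \<le> \<tau>\<^sup>2" "24 * \<tau> \<le> \<sigma>\<^sup>2" "14 * \<sigma> \<le> \<theta>\<^sup>2"
    and cost: "\<And>X b \<rho> p. size X = n \<Longrightarrow> (\<And>p. p \<in># X \<Longrightarrow> dist p b \<le> \<rho>) \<Longrightarrow> p \<in># X \<Longrightarrow> dist p (G X) \<le> \<beta> * \<rho>"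
  shows "1/2 - 6 * \<theta> \<le> (\<beta> * (1 - sqrt (1/2) + 3 * \<theta>))\<^sup>2"
proof -
  define L where "L = norm z"
  define D where "D = a + z"
  define y where "y = D + L *\<^sub>R \<nu>"
  have L: "0 < L" using z by (simp add: L_def)
  have "\<theta>\<^sup>2 \<le> \<theta>" using pos by (simp add: power2_eq_square mult_left_le)
  with small pos have \<sigma>\<theta>: "\<sigma> \<le> \<theta>" by linarith
  then have "\<sigma>\<^sup>2 \<le> \<sigma>" using pos by (simp add: power2_eq_square mult_left_le)
  with small pos have \<tau>\<sigma>: "\<tau> \<le> \<sigma>" by linarith
  then have \<tau>2: "\<tau>\<^sup>2 \<le> \<tau>" using pos \<sigma>\<theta> by (simp add: power2_eq_square mult_left_le)
  have aD: "dist a D = L" and yD: "dist y D = L"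
    using \<nu> L by (simp_all add: D_def y_def L_def dist_norm)
  have ay2: "(dist a y)\<^sup>2 = 2 * L\<^sup>2"
  proof -
    have "(dist a y)\<^sup>2 = (norm (z + L *\<^sub>R \<nu>))\<^sup>2"
      by (subst dist_commute) (simp add: y_def D_def dist_norm)
    also have "\<dots> = (norm z)\<^sup>2 + (norm (L *\<^sub>R \<nu>))\<^sup>2"
      using \<nu> by (intro norm_add_Pythagorean) (simp add: orthogonal_def inner_commute)
    finally show ?thesis using \<nu> by (simp add: L_def)
  qed
  \<comment> \<open>Since \<open>D\<close> is an option, the outcome lies in the disc of radius
    \<open>L\<close> about \<open>y\<close>. That disc touches the line through \<open>a\<close> and
    \<open>D\<close> at \<open>D\<close>, and \<open>wedge\<close> lets the outcome pass the line
    only by order \<open>\<kappa> * L\<close>.\<close>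
  have near: "dist (two_cluster j a y) D \<le> \<tau> * L" if j: "j \<in> {k, Suc k}" for j
  proof -
    define u where "u = two_cluster j a y - D"
    have sub: "option_set (Suc k) a \<subseteq> option_set j a" "option_set j a \<subseteq> option_set k a"
      using j option_set_Suc_subset[OF k] by auto
    have "dist y (two_cluster j a y) \<le> dist y D"
      using j k z sub by (intro two_cluster_nearest) (auto simp: D_def)
    then have le: "norm (L *\<^sub>R \<nu> - u) \<le> L"
      using yD by (simp add: u_def y_def dist_norm algebra_simps)
    have ra: "two_cluster j a y - a = z + u" by (simp add: u_def D_def)
    have "norm (z + u) \<le> 3 * L"
    proof -
      have "norm (z + u) = norm (z + L *\<^sub>R \<nu> - (L *\<^sub>R \<nu> - u))" by simp
      also have "\<dots> \<le> norm (z + L *\<^sub>R \<nu>) + norm (L *\<^sub>R \<nu> - u)" by (rule norm_triangle_ineq4)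
      also have "norm (z + L *\<^sub>R \<nu>) \<le> L + L"
        using norm_triangle_ineq[of z "L *\<^sub>R \<nu>"] \<nu> L by (simp add: L_def)
      finally show ?thesis using le by simp
    qed
    moreover have "\<nu> \<bullet> (z + u) \<le> \<kappa> * norm (z + u)"
      using wedge[of "two_cluster j a y"] two_cluster_in_option_set[of j a y] sub j k ra by auto
    ultimately have "\<nu> \<bullet> (z + u) \<le> \<kappa> * (3 * L)"
      using pos by (meson mult_left_mono order_trans)
    then have \<nu>u: "\<nu> \<bullet> u \<le> 3 * \<kappa> * L" using \<nu> by (simp add: inner_right_distrib)
    have "(norm (L *\<^sub>R \<nu> - u))\<^sup>2 \<le> L\<^sup>2" using le by (intro power_mono) auto
    moreover have "(norm (L *\<^sub>R \<nu> - u))\<^sup>2 = L\<^sup>2 - 2 * L * (\<nu> \<bullet> u) + (norm u)\<^sup>2"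
    proof -
      have "\<nu> \<bullet> \<nu> = 1" using \<nu> by (simp add: norm_eq_1)
      then show ?thesis unfolding power2_norm_eq_inner
        by (simp add: inner_diff inner_commute power2_eq_square algebra_simps)
    qed
    ultimately have "(norm u)\<^sup>2 \<le> 2 * L * (\<nu> \<bullet> u)" by linarith
    also have "\<dots> \<le> 2 * L * (3 * \<kappa> * L)" using \<nu>u L by (intro mult_left_mono) auto
    also have "\<dots> = 6 * \<kappa> * L\<^sup>2" by (simp add: power2_eq_square)
    also have "\<dots> \<le> \<tau>\<^sup>2 * L\<^sup>2" using small by (intro mult_right_mono) auto
    finally have "(norm u)\<^sup>2 \<le> (\<tau> * L)\<^sup>2" by (simp add: power_mult_distrib)
    then have "norm u \<le> \<tau> * L" by (rule power2_le_imp_le) (use pos L in simp)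
    then show ?thesis by (simp add: u_def dist_norm)
  qed
  define c :: real where "c = 1 - sqrt (1/2)"
  have "1/2 \<le> sqrt (1/2)" by (rule real_le_rsqrt) (simp add: power2_eq_square)
  moreover have "sqrt (1/2) \<le> 1" by simp
  ultimately have c: "0 \<le> c" "c \<le> 1/2" by (auto simp: c_def)
  define l where "l = n - Suc k"
  have nk: "n - k = Suc l" and kl: "k + l + 1 = n" using k by (auto simp: l_def)
  \<comment> \<open>The clusters are contracted towards the actual outcomes \<open>P\<close> and
    \<open>Q\<close> instead of \<open>D\<close>, so that \<open>move_toward\<close> applies without
    error in \<open>GP\<close> and \<open>HQ\<close>. Besides \<open>k\<close> and \<open>l\<close>
    clustered agents one agent remains, and \<open>H p\<close> is the outcome when it reports
    \<open>p\<close>.\<close>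
  define P where "P = two_cluster (Suc k) a y"
  define x\<^sub>1 where "x\<^sub>1 = P + c *\<^sub>R (a - P)"
  define Q where "Q = two_cluster k x\<^sub>1 y"
  define y\<^sub>1 where "y\<^sub>1 = Q + c *\<^sub>R (y - Q)"
  define H where "H p = G (add_mset p (replicate_mset k x\<^sub>1 + replicate_mset l y\<^sub>1))" for p
  have PD: "dist P D \<le> \<tau> * L" using near[of "Suc k"] by (simp add: P_def)
  have x\<^sub>1P: "dist x\<^sub>1 P = c * dist a P" and y\<^sub>1Q: "dist y\<^sub>1 Q = c * dist y Q"
    using c by (simp_all add: x\<^sub>1_def y\<^sub>1_def dist_norm)
  \<comment> \<open>Here all \<open>k\<close> agents at \<open>a\<close> move to
    \<open>x\<^sub>1\<close>, but their outcome before the move is \<open>?R\<close>, not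
    \<open>P\<close>; the gap between the two is the error \<open>t\<close> in
    \<open>crescent_dist\<close>.\<close>
  have QP: "dist Q P \<le> \<sigma> * L"
  proof -
    define t where "t = 2 * \<tau> * L"
    let ?R = "two_cluster k a y"
    have RP: "dist ?R P \<le> t"
      using near[of k] PD dist_triangle2[of ?R P D] by (simp add: t_def)
    have "dist a ?R \<le> dist a Q" "dist x\<^sub>1 Q \<le> dist x\<^sub>1 ?R"
      using k two_cluster_sp1 by (auto simp: Q_def)
    then have "dist a P - t \<le> dist a Q" "dist x\<^sub>1 Q \<le> c * dist a P + t"
      using RP x\<^sub>1P dist_triangle[of a P ?R] dist_triangle[of x\<^sub>1 ?R P]
      by (auto simp: dist_commute)
    then have "(dist Q P)\<^sup>2 \<le> 4 * t * dist a P + 2 * t\<^sup>2"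
      using c pos L by (intro crescent_dist[of a P t Q c]) (auto simp: x\<^sub>1_def t_def)
    also have "\<dots> \<le> 4 * t * (2 * L) + 2 * t\<^sup>2"
    proof -
      have "\<tau> * L \<le> 1 * L" using L \<tau>\<sigma> \<sigma>\<theta> pos by (intro mult_right_mono) auto
      then have "dist a P \<le> 2 * L"
        using dist_triangle2[of a P D] PD aD by linarith
      then show ?thesis using pos L by (intro add_right_mono mult_left_mono) (auto simp: t_def)
    qed
    also have "\<dots> = (16 * \<tau> + 8 * \<tau>\<^sup>2) * L\<^sup>2"
      by (simp add: t_def power2_eq_square algebra_simps)
    also have "\<dots> \<le> \<sigma>\<^sup>2 * L\<^sup>2" using small \<tau>2 by (intro mult_right_mono) auto
    finally have "(dist Q P)\<^sup>2 \<le> (\<sigma> * L)\<^sup>2" by (simp add: power_mult_distrib)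
    then show ?thesis by (rule power2_le_imp_le) (use pos L in simp)
  qed
  have QD: "dist Q D \<le> (\<tau> + \<sigma>) * L"
    using dist_triangle[of Q D P] QP PD by (simp add: algebra_simps)
  have GP: "G (replicate_mset l y + add_mset a (replicate_mset k x\<^sub>1)) = P"
    using move_toward[of k "add_mset a (replicate_mset l y)" a P c] c kl
    by (simp add: P_def two_cluster_def x\<^sub>1_def l_def add.commute)
  have HQ: "H y = Q"
    using move_toward[of l "add_mset y (replicate_mset k x\<^sub>1)" y Q c] c kl nk
    by (simp add: Q_def two_cluster_def y\<^sub>1_def H_def add.commute)
  have Ha: "H a = G (replicate_mset l y\<^sub>1 + add_mset a (replicate_mset k x\<^sub>1))"
    by (simp add: H_def add.commute)
  have yQ: "dist y Q \<le> 3 * L" "(1 - 3 * \<theta>) * L \<le> dist y Q"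
  proof -
    have "(\<tau> + \<sigma>) * L \<le> 2 * L" using L \<tau>\<sigma> \<sigma>\<theta> pos by (intro mult_right_mono) auto
    then show "dist y Q \<le> 3 * L" using dist_triangle2[of y Q D] QD yD by linarith
    have "(\<tau> + \<sigma>) * L \<le> (3 * \<theta>) * L" using L \<tau>\<sigma> \<sigma>\<theta> pos by (intro mult_right_mono) auto
    then show "(1 - 3 * \<theta>) * L \<le> dist y Q"
      using dist_triangle[of y D Q] QD yD by (simp add: algebra_simps)
  qed
  \<comment> \<open>With the lone agent at \<open>a\<close>, the \<open>l\<close> others move from
    \<open>y\<close> towards \<open>Q\<close>, while their outcome before the move is
    \<open>P\<close>; the error is now \<open>dist P Q\<close>.\<close>
  have HaQ: "dist (H a) Q \<le> \<theta> * L"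
  proof -
    define t where "t = \<sigma> * L"
    have "l + size (add_mset a (replicate_mset k x\<^sub>1)) = n" using kl by simp
    from coalition_sp[OF this, of y y\<^sub>1] coalition_sp[OF this, of y\<^sub>1 y]
    have "dist y P \<le> dist y (H a)" "dist y\<^sub>1 (H a) \<le> dist y\<^sub>1 P" by (simp_all only: GP Ha)
    then have "dist y Q - t \<le> dist y (H a)" "dist y\<^sub>1 (H a) \<le> c * dist y Q + t"
      using QP y\<^sub>1Q dist_triangle[of y Q P] dist_triangle[of y\<^sub>1 P Q]
      by (auto simp: dist_commute t_def)
    then have "(dist (H a) Q)\<^sup>2 \<le> 4 * t * dist y Q + 2 * t\<^sup>2"
      using c pos L by (intro crescent_dist[of y Q t "H a" c]) (auto simp: y\<^sub>1_def t_def)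
    also have "\<dots> \<le> 4 * t * (3 * L) + 2 * t\<^sup>2"
      using yQ pos L by (intro add_right_mono mult_left_mono) (auto simp: t_def)
    also have "\<dots> = (12 * \<sigma> + 2 * \<sigma>\<^sup>2) * L\<^sup>2"
      by (simp add: t_def power2_eq_square algebra_simps)
    also have "\<dots> \<le> \<theta>\<^sup>2 * L\<^sup>2" using small \<open>\<sigma>\<^sup>2 \<le> \<sigma>\<close> by (intro mult_right_mono) auto
    finally have "(dist (H a) Q)\<^sup>2 \<le> (\<theta> * L)\<^sup>2" by (simp add: power_mult_distrib)
    then show ?thesis by (rule power2_le_imp_le) (use pos L in simp)
  qed
  have aHa: "(1 - 3 * \<theta>) * L \<le> dist a (H a)"
  proof -
    have "(\<tau> + \<sigma> + \<theta>) * L \<le> (3 * \<theta>) * L" using L \<tau>\<sigma> \<sigma>\<theta> pos by (intro mult_right_mono) auto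
    then show ?thesis
      using dist_triangle[of a D "H a"] dist_triangle[of "H a" D Q] HaQ QD aD
      by (simp add: algebra_simps)
  qed
  define C where "C = midpoint a y"
  have sq: "(1 - 6 * \<theta>) * L\<^sup>2 \<le> x\<^sup>2" if x: "(1 - 3 * \<theta>) * L \<le> x" for x
  proof (cases "3 * \<theta> \<le> 1")
    case True
    then have "((1 - 3 * \<theta>) * L)\<^sup>2 \<le> x\<^sup>2" using x L by (intro power_mono) auto
    moreover have "((1 - 3 * \<theta>) * L)\<^sup>2 = (1 - 6 * \<theta>) * L\<^sup>2 + 9 * \<theta>\<^sup>2 * L\<^sup>2"
      by (simp add: power2_eq_square algebra_simps)
    ultimately show ?thesis by (smt (verit) mult_nonneg_nonneg zero_le_power2)
  next
    case False
    then have "(1 - 6 * \<theta>) * L\<^sup>2 \<le> 0" by (intro mult_nonpos_nonneg) auto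
    then show ?thesis by (smt (verit) zero_le_power2)
  qed
  \<comment> \<open>The lone agent must not gain by reporting \<open>C\<close> from either
    \<open>a\<close> or \<open>y\<close>, which keeps \<open>H C\<close> away from both; the median
    formula converts this into distance from the midpoint.\<close>
  have lower: "(1/2 - 6 * \<theta>) * L\<^sup>2 \<le> (dist C (H C))\<^sup>2"
  proof -
    have "dist a (H a) \<le> dist a (H C)" "dist y (H y) \<le> dist y (H C)"
      unfolding H_def using kl by (intro sp; simp)+
    then have "(1 - 6 * \<theta>) * L\<^sup>2 \<le> (dist a (H C))\<^sup>2" "(1 - 6 * \<theta>) * L\<^sup>2 \<le> (dist y (H C))\<^sup>2"
      using sq aHa yQ HQ by auto
    moreover have "(dist C (H C))\<^sup>2 = ((dist a (H C))\<^sup>2 + (dist y (H C))\<^sup>2) / 2 - (dist a y)\<^sup>2 / 4"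
      unfolding C_def midpoint_def dist_norm power2_norm_eq_inner
      by (simp add: inner_diff inner_add inner_commute field_simps)
    ultimately show ?thesis using ay2 by (simp add: algebra_simps)
  qed
  \<comment> \<open>Centre of the enclosing disc: the corner opposite \<open>D\<close> of the square
    of side \<open>c * L\<close> whose corners next to \<open>D\<close> are approximately
    \<open>x\<^sub>1\<close> and \<open>y\<^sub>1\<close>.\<close>
  define b where "b = D + c *\<^sub>R (L *\<^sub>R \<nu> - z)"
  have Cb: "dist C b = c * L"
  proof -
    have "C - b = (1/2 - c) *\<^sub>R (L *\<^sub>R \<nu> - z)"
      by (simp add: C_def b_def midpoint_def y_def D_def algebra_simps flip: scaleR_add_left)
    then have "(dist C b)\<^sup>2 = (1/2 - c)\<^sup>2 * (norm (L *\<^sub>R \<nu> - z))\<^sup>2"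
      by (simp add: dist_norm power_mult_distrib)
    also have "(norm (L *\<^sub>R \<nu> - z))\<^sup>2 = 2 * L\<^sup>2"
    proof -
      have "\<nu> \<bullet> \<nu> = 1" "z \<bullet> z = L\<^sup>2"
        using \<nu> by (auto simp: norm_eq_1 L_def power2_norm_eq_inner)
      then show ?thesis unfolding power2_norm_eq_inner using \<nu>
        by (simp add: inner_diff inner_commute power2_eq_square algebra_simps)
    qed
    also have "(1/2 - c)\<^sup>2 * (2 * L\<^sup>2) = (c * L)\<^sup>2"
    proof -
      have "(sqrt (1/2))\<^sup>2 = 1/2" by simp
      then have "2 * (1/2 - c)\<^sup>2 = c\<^sup>2"
        unfolding c_def by (simp add: power2_eq_square algebra_simps del: real_sqrt_pow2)
      then show ?thesis by (simp add: power_mult_distrib flip: mult.assoc)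
    qed
    finally show ?thesis using c L by (simp add: power2_eq_iff_nonneg)
  qed
  have "dist x\<^sub>1 b \<le> (c + 3 * \<theta>) * L"
  proof -
    have "x\<^sub>1 - b = (1 - c) *\<^sub>R (P - D) - (c * L) *\<^sub>R \<nu>"
      by (simp add: x\<^sub>1_def b_def D_def algebra_simps)
    then have "dist x\<^sub>1 b \<le> norm ((1 - c) *\<^sub>R (P - D)) + norm ((c * L) *\<^sub>R \<nu>)"
      by (simp add: dist_norm norm_triangle_ineq4 del: norm_scaleR)
    also have "\<dots> = (1 - c) * dist P D + c * L" using c L \<nu> by (simp add: dist_norm)
    also have "\<dots> \<le> 1 * (\<tau> * L) + c * L"
      using c PD by (intro add_right_mono mult_mono) auto
    also have "\<dots> \<le> (c + 3 * \<theta>) * L"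
      using L \<tau>\<sigma> \<sigma>\<theta> pos mult_right_mono[of \<tau> "3 * \<theta>" L] by (simp add: algebra_simps)
    finally show ?thesis .
  qed
  moreover have "dist y\<^sub>1 b \<le> (c + 3 * \<theta>) * L"
  proof -
    have "y\<^sub>1 - b = (1 - c) *\<^sub>R (Q - D) + c *\<^sub>R z"
      by (simp add: y\<^sub>1_def b_def y_def algebra_simps)
    then have "dist y\<^sub>1 b \<le> norm ((1 - c) *\<^sub>R (Q - D)) + norm (c *\<^sub>R z)"
      by (simp add: dist_norm norm_triangle_ineq del: norm_scaleR)
    also have "\<dots> = (1 - c) * dist Q D + c * L" using c by (simp add: dist_norm L_def)
    also have "\<dots> \<le> 1 * ((\<tau> + \<sigma>) * L) + c * L"
      using c QD by (intro add_right_mono mult_mono) auto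
    also have "\<dots> \<le> (c + 3 * \<theta>) * L"
      using L \<tau>\<sigma> \<sigma>\<theta> pos mult_right_mono[of "\<tau> + \<sigma>" "3 * \<theta>" L] by (simp add: algebra_simps)
    finally show ?thesis .
  qed
  moreover have "dist C b \<le> (c + 3 * \<theta>) * L"
    using Cb pos L by (simp add: algebra_simps)
  ultimately have "dist C (H C) \<le> \<beta> * ((c + 3 * \<theta>) * L)"
    unfolding H_def using kl
    by (intro cost[where b = b]) (auto split: if_splits)
  then have "(dist C (H C))\<^sup>2 \<le> (\<beta> * ((c + 3 * \<theta>) * L))\<^sup>2" by (intro power_mono) auto
  with lower have "(1/2 - 6 * \<theta>) * L\<^sup>2 \<le> (\<beta> * (c + 3 * \<theta>))\<^sup>2 * L\<^sup>2"
    by (simp add: power_mult_distrib mult.assoc)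
  then show ?thesis using L by (simp add: c_def)
qed

end

section \<open>Auxiliary facts on plane vectors, sequences and angles\<close>

text \<open>This writes \<open>u \<bullet> v\<close> through the inner products with
  \<open>r\<close> and \<open>s\<close>, by the adjugate of their Gram matrix; the squared
  determinant is the Gram determinant.\<close>

lemma gram_plane:
  fixes u v r s :: "real ^ 2"
  shows "(u \<bullet> v) * (r $ 1 * s $ 2 - r $ 2 * s $ 1)\<^sup>2 =
    (u \<bullet> r) * (v \<bullet> r) * (s \<bullet> s) - ((u \<bullet> r) * (v \<bullet> s) + (u \<bullet> s) * (v \<bullet> r)) * (r \<bullet> s)
      + (u \<bullet> s) * (v \<bullet> s) * (r \<bullet> r)"
  by (simp add: inner_vec_def sum_2 power2_eq_square algebra_simps)

lemma small_gap:
  fixes s :: "nat \<Rightarrow> real"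
  assumes "0 < N"
  obtains k where "m \<le> k" "k < m + N" "s k - s (Suc k) \<le> (s m - s (m + N)) / N"
proof -
  let ?g = "(s m - s (m + N)) / N"
  have "\<exists>i<N. s (m + i) - s (Suc (m + i)) \<le> ?g"
  proof (rule ccontr)
    assume "\<not> ?thesis"
    then have "(\<Sum>i<N. ?g) < (\<Sum>i<N. s (m + i) - s (Suc (m + i)))"
      using assms by (intro sum_strict_mono) auto
    also have "\<dots> = s m - s (m + N)"
      using sum_lessThan_telescope'[of "\<lambda>i. s (m + i)" N] by simp
    finally show False using assms by simp
  qed
  then obtain i where "i < N" "s (m + i) - s (Suc (m + i)) \<le> ?g" by blast
  then show thesis using that[of "m + i"] by simp
qed

text \<open>Reading \<open>(p, s)\<close> and \<open>(p', s')\<close> as cosine and sine of two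
  angles, the left side is the sine of their difference. The sine is flat near 90 degrees, so an
  excess \<open>\<eta>\<close> in it can mean an angle of order \<open>sqrt \<eta>\<close>; hence
  the square in the bound on \<open>\<eta>\<close>.\<close>

lemma cross_le_of_near_extreme:
  fixes p s p' s' \<kappa> :: real
  assumes nonneg: "0 \<le> p" "0 \<le> p'" "0 \<le> s"
    and unit: "p\<^sup>2 + s\<^sup>2 = 1" "p'\<^sup>2 + s'\<^sup>2 = 1"
    and \<eta>: "s' \<le> s + \<eta>" "\<eta> \<le> \<kappa>\<^sup>2 / 8" and \<kappa>: "0 \<le> \<kappa>" "\<kappa> \<le> 1"
  shows "p * s' - s * p' \<le> \<kappa>"
proof -
  have "p\<^sup>2 \<le> 1" "s\<^sup>2 \<le> 1" "s'\<^sup>2 \<le> 1"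
    using unit zero_le_power2[of p] zero_le_power2[of s] zero_le_power2[of p'] by linarith+
  then have le1: "p \<le> 1" "s \<le> 1" "s' \<le> 1"
    by (simp_all add: abs_square_le_1 abs_le_iff)
  consider "s' \<le> 0" | "0 < s'" "s' \<le> s" | "s < s'" by linarith
  then show ?thesis
  proof cases
    case 1
    then have "p * s' \<le> 0" "0 \<le> s * p'" using nonneg by (auto intro: mult_nonneg_nonpos)
    then show ?thesis using \<kappa> by linarith
  next
    case 2
    then have "s'\<^sup>2 \<le> s\<^sup>2" by (intro power_mono) auto
    then have "p\<^sup>2 \<le> p'\<^sup>2" using unit by linarith
    then have "p \<le> p'" using nonneg power2_le_imp_le by blast
    then have "p * s' \<le> p' * s" using 2 nonneg by (intro mult_mono) auto
    then show ?thesis using \<kappa> by (simp add: mult.commute)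
  next
    case 3
    then have "s\<^sup>2 \<le> s'\<^sup>2" using nonneg by (intro power_mono) auto
    then have "p'\<^sup>2 \<le> p\<^sup>2" using unit by linarith
    then have pp: "p' \<le> p" using nonneg power2_le_imp_le by blast
    have "(p - p')\<^sup>2 \<le> (p - p') * (p + p')"
      unfolding power2_eq_square using pp nonneg by (intro mult_left_mono) auto
    also have "\<dots> = p\<^sup>2 - p'\<^sup>2" by (simp add: power2_eq_square algebra_simps)
    also have "\<dots> = s'\<^sup>2 - s\<^sup>2" using unit by linarith
    also have "\<dots> = (s' - s) * (s' + s)" by (simp add: power2_eq_square algebra_simps)
    also have "\<dots> \<le> (\<kappa>\<^sup>2 / 8) * 2" using 3 nonneg \<eta> le1 by (intro mult_mono) auto
    also have "\<dots> = (\<kappa> / 2)\<^sup>2" by (simp add: power_divide)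
    finally have "p - p' \<le> \<kappa> / 2" by (rule power2_le_imp_le) (use \<kappa> in simp)
    have "p * s' - s * p' = p * (s' - s) + s * (p - p')" by (simp add: algebra_simps)
    also have "\<dots> \<le> 1 * (\<kappa>\<^sup>2 / 8) + 1 * (\<kappa> / 2)"
    proof (rule add_mono)
      show "p * (s' - s) \<le> 1 * (\<kappa>\<^sup>2 / 8)" using 3 \<eta> le1 by (intro mult_mono) auto
      show "s * (p - p') \<le> 1 * (\<kappa> / 2)"
        using \<open>p - p' \<le> \<kappa> / 2\<close> le1 pp by (intro mult_mono) auto
    qed
    also have "\<dots> \<le> \<kappa>"
    proof -
      have "\<kappa>\<^sup>2 \<le> \<kappa>" using \<kappa> by (simp add: power2_eq_square mult_left_le)
      then show ?thesis using \<kappa> by simp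
    qed
    finally show ?thesis .
  qed
qed

section \<open>Option sets in the plane: right angles and nearly equal wedges\<close>

locale planar_rule = truthful_rule G n for G :: "(real ^ 2) multiset \<Rightarrow> real ^ 2" and n
begin

text \<open>With equal halves the two clusters are interchangeable, so
  \<open>option_set_halfspace\<close> puts the outcome \<open>E\<close> for peaks
  \<open>r, s\<close> beyond the perpendiculars to \<open>r - a\<close> at \<open>r\<close> and to
  \<open>s - a\<close> at \<open>s\<close>. If the angle at \<open>a\<close> were obtuse, the angle
  at \<open>E\<close> would be acute, against \<open>two_cluster_angle\<close>.\<close>

lemma option_set_half_angle:
  assumes n: "n = 2 * m" and r: "r \<in> option_set m a" and s: "s \<in> option_set m a"
  shows "0 \<le> (r - a) \<bullet> (s - a)"
proof (rule ccontr)
  assume "\<not> ?thesis"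
  then have neg: "(r - a) \<bullet> (s - a) < 0" by simp
  have sym: "two_cluster m x y = two_cluster m y x" for x y
  proof -
    have "n - m = m" using n by simp
    then show ?thesis unfolding two_cluster_def by (simp only: add.commute)
  qed
  have m: "m \<le> n" using n by simp
  define E where "E = two_cluster m r s"
  define u where "u = r - E"
  define v where "v = s - E"
  have "E \<in> option_set m r" "E \<in> option_set m s"
    using two_cluster_in_option_set[OF m] sym by (metis E_def)+
  moreover have "two_cluster m r a = r" "two_cluster m s a = s"
    using r s sym by (simp_all add: option_set_def)
  ultimately have "(a - r) \<bullet> (E - r) \<le> 0" "(a - s) \<bullet> (E - s) \<le> 0"
    using option_set_halfspace[OF m] by blast+
  then have ur: "u \<bullet> (r - a) \<le> 0" and vs: "v \<bullet> (s - a) \<le> 0"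
    by (simp_all add: u_def v_def inner_diff inner_commute)
  have uv: "u \<bullet> v \<le> 0" using two_cluster_angle[OF m, of r s] by (simp add: E_def u_def v_def)
  let ?r = "r - a" and ?s = "s - a"
  have v: "u - ?r + ?s = v" and u: "v + ?r - ?s = u" by (simp_all add: u_def v_def)
  have r0: "0 < ?r \<bullet> ?r" and s0: "0 < ?s \<bullet> ?s" using neg by (auto simp: inner_gt_zero_iff)
  have "(x - y + w) \<bullet> y = x \<bullet> y - y \<bullet> y + y \<bullet> w" for x y w :: "real ^ 2"
    by (simp add: inner_diff_left inner_add_left inner_commute[of w])
  from this[of u ?r ?s] have "v \<bullet> ?r = u \<bullet> ?r - ?r \<bullet> ?r + ?r \<bullet> ?s" by (simp only: v)
  then have vr: "v \<bullet> ?r < 0" using ur neg r0 by linarith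
  have "(x + y - w) \<bullet> w = x \<bullet> w + y \<bullet> w - w \<bullet> w" for x y w :: "real ^ 2"
    by (simp add: inner_diff_left inner_add_left)
  from this[of v ?r ?s] have "u \<bullet> ?s = v \<bullet> ?s + ?r \<bullet> ?s - ?s \<bullet> ?s" by (simp only: u)
  then have us: "u \<bullet> ?s < 0" using vs neg s0 by linarith
  have "0 \<le> (u \<bullet> ?r) * (v \<bullet> ?r) * (?s \<bullet> ?s)" "0 \<le> (u \<bullet> ?s) * (v \<bullet> ?s) * (?r \<bullet> ?r)"
    using ur vs us vr by (intro mult_nonneg_nonneg mult_nonpos_nonpos; simp)+
  moreover have "((u \<bullet> ?r) * (v \<bullet> ?s) + (u \<bullet> ?s) * (v \<bullet> ?r)) * (?r \<bullet> ?s) < 0"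
    using ur vs us vr neg
    by (intro mult_pos_neg add_nonneg_pos mult_nonpos_nonpos mult_neg_neg) auto
  ultimately have "0 < (u \<bullet> v) * (?r $ 1 * ?s $ 2 - ?r $ 2 * ?s $ 1)\<^sup>2"
    unfolding gram_plane by linarith
  then show False using uv by (simp add: zero_less_mult_iff)
qed

lemma near_extreme_option:
  assumes n: "n = 2 * N + 2" and N: "16 / \<kappa>\<^sup>2 \<le> N" and \<kappa>: "0 < \<kappa>" "\<kappa> \<le> 1"
    and b: "b \<in> option_set (n - 1) a" "b \<noteq> a"
  obtains k z \<nu> where "Suc k \<le> n" "a + z \<in> option_set (Suc k) a" "z \<noteq> 0"
    "norm \<nu> = 1" "\<nu> \<bullet> z = 0"
    "\<And>r. r \<in> option_set k a \<Longrightarrow> \<nu> \<bullet> (r - a) \<le> \<kappa> * norm (r - a)"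
proof -
  define d where "d = (b - a) /\<^sub>R norm (b - a)"
  define e :: "real ^ 2" where "e = vector [- d $ 2, d $ 1]"
  \<comment> \<open>The sines of the signed angles, seen from \<open>a\<close>, between
    \<open>d\<close> and the options; \<open>s k\<close> marks the upper edge of the wedge.\<close>
  define V where "V k = (\<lambda>r. e \<bullet> (r - a) / norm (r - a)) ` (option_set k a - {a})" for k
  define s where "s k = Sup (V k)" for k
  have d1: "norm d = 1" using b by (simp add: d_def)
  then have dd: "(d $ 1)\<^sup>2 + (d $ 2)\<^sup>2 = 1"
    by (simp add: norm_eq_1 inner_vec_def sum_2 power2_eq_square)
  have decomp: "(d \<bullet> v)\<^sup>2 + (e \<bullet> v)\<^sup>2 = (norm v)\<^sup>2" for v
  proof -
    have "(d \<bullet> v)\<^sup>2 + (e \<bullet> v)\<^sup>2 = ((d $ 1)\<^sup>2 + (d $ 2)\<^sup>2) * (norm v)\<^sup>2"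
      unfolding power2_norm_eq_inner
      by (simp add: e_def inner_vec_def sum_2 power2_eq_square algebra_simps)
    then show ?thesis using dd by simp
  qed
  have V_bound: "x \<in> V k \<Longrightarrow> \<bar>x\<bar> \<le> 1" for x k
  proof -
    have "\<bar>e \<bullet> v\<bar> \<le> norm v" for v
    proof -
      have "(e \<bullet> v)\<^sup>2 \<le> (norm v)\<^sup>2" using decomp[of v] by (smt (verit) zero_le_power2)
      then show ?thesis by (simp add: abs_le_square_iff[symmetric])
    qed
    then show "x \<in> V k \<Longrightarrow> \<bar>x\<bar> \<le> 1" by (auto simp: V_def divide_le_eq_1)
  qed
  have bdd: "bdd_above (V k)" for k using V_bound by (fastforce intro: bdd_aboveI[of _ 1])
  have V0: "0 \<in> V k" if "k \<le> n - 1" for k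
  proof -
    have "e \<bullet> (b - a) = 0"
    proof -
      have "e \<bullet> d = 0" by (simp add: e_def inner_vec_def sum_2)
      then show ?thesis using b by (simp add: d_def)
    qed
    moreover have "b \<in> option_set k a" using option_set_antimono[OF that, of a] b by auto
    ultimately show ?thesis using b unfolding V_def by force
  qed
  have s0: "0 \<le> s k" if "k \<le> n - 1" for k
    unfolding s_def using V0[OF that] bdd by (rule cSup_upper)
  have s1: "s k \<le> 1" if "k \<le> n - 1" for k
    unfolding s_def using V0[OF that] V_bound by (intro cSup_least) fastforce+
  have "0 < 16 / \<kappa>\<^sup>2" using \<kappa> by simp
  with N have Npos: "0 < N" by (intro Nat.gr0I) auto
  \<comment> \<open>The window starts at \<open>N + 1\<close>, half of \<open>n\<close>, where
    angles are at most 90 degrees, and ends at \<open>n - 1\<close>, where \<open>b\<close> is still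
    an option.\<close>
  obtain k where k: "N + 1 \<le> k" "k < N + 1 + N"
    and gap: "s k - s (Suc k) \<le> (s (N + 1) - s (N + 1 + N)) / N"
    using small_gap[OF Npos] .
  have kn: "Suc k \<le> n - 1" "N + 1 \<le> n - 1" "N + 1 + N \<le> n - 1" using k n by auto
  have "(s (N + 1) - s (N + 1 + N)) / N \<le> 1 / N"
    using s1[OF kn(2)] s0[OF kn(3)] by (intro divide_right_mono) auto
  with gap have gap: "s k - s (Suc k) \<le> 1 / N" by linarith
  \<comment> \<open>The supremum need not be attained, so \<open>1 / N\<close> is given away; the
    sine 0 of \<open>b\<close> itself serves when the supremum is too small to guarantee a
    nonnegative choice.\<close>
  obtain \<xi> where \<xi>: "\<xi> \<in> V (Suc k)" "0 \<le> \<xi>" "s (Suc k) - 1 / N \<le> \<xi>"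
  proof (cases "s (Suc k) \<le> 1 / N")
    case True
    then show thesis using that[of 0] V0[OF kn(1)] by simp
  next
    case False
    have "s (Suc k) - 1 / N < Sup (V (Suc k))" using Npos by (simp add: s_def)
    then obtain x where "x \<in> V (Suc k)" "s (Suc k) - 1 / N < x"
      using less_cSupE V0[OF kn(1)] by (metis empty_iff)
    then show thesis using that[of x] False by simp
  qed
  then obtain q where q: "q \<in> option_set (Suc k) a" "q \<noteq> a"
    and \<xi>q: "\<xi> = e \<bullet> (q - a) / norm (q - a)"
    unfolding V_def by auto
  define z where "z = q - a"
  define p where "p v = (d \<bullet> v) / norm v" for v
  have d_nonneg: "0 \<le> d \<bullet> (r - a)" if "r \<in> option_set (N + 1) a" for r
  proof -
    have "b \<in> option_set (N + 1) a" using option_set_antimono[OF kn(2), of a] b by auto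
    from option_set_half_angle[OF _ this that] n
    show ?thesis by (simp add: d_def)
  qed
  have unit: "(p v)\<^sup>2 + (e \<bullet> v / norm v)\<^sup>2 = 1" if "v \<noteq> 0" for v
  proof -
    have "(p v)\<^sup>2 + (e \<bullet> v / norm v)\<^sup>2 = ((d \<bullet> v)\<^sup>2 + (e \<bullet> v)\<^sup>2) / (norm v)\<^sup>2"
      by (simp add: p_def power_divide add_divide_distrib)
    then show ?thesis using that by (simp add: decomp)
  qed
  \<comment> \<open>The unit vector along \<open>z\<close> is
    \<open>p z *\<^sub>R d + \<xi> *\<^sub>R e\<close>; this is its quarter turn.\<close>
  define \<nu> where "\<nu> = p z *\<^sub>R e - \<xi> *\<^sub>R d"
  have z0: "z \<noteq> 0" using q by (simp add: z_def)
  have \<xi>z: "\<xi> = e \<bullet> z / norm z" by (simp add: \<xi>q z_def)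
  have sub: "option_set (Suc k) a \<subseteq> option_set k a" "option_set k a \<subseteq> option_set (N + 1) a"
    using option_set_Suc_subset[of k a] option_set_antimono[of "N + 1" k a] k kn by auto
  show thesis
  proof
    show "Suc k \<le> n" using kn by simp
    show "a + z \<in> option_set (Suc k) a" using q by (simp add: z_def)
    show "z \<noteq> 0" by (fact z0)
    have "d \<bullet> d = 1" "e \<bullet> e = 1" "e \<bullet> d = 0" "d \<bullet> e = 0"
      using dd by (simp_all add: e_def inner_vec_def sum_2 power2_eq_square add.commute)
    then have "\<nu> \<bullet> \<nu> = (p z)\<^sup>2 + \<xi>\<^sup>2"
      unfolding \<nu>_def by (simp add: inner_diff power2_eq_square)
    then show "norm \<nu> = 1" using unit[OF z0] \<xi>z by (simp add: norm_eq_1)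
    show "\<nu> \<bullet> z = 0"
      unfolding \<nu>_def by (simp add: \<xi>z p_def inner_diff_left)
    show "\<nu> \<bullet> (r - a) \<le> \<kappa> * norm (r - a)" if r: "r \<in> option_set k a" for r
    proof (cases "r = a")
      case False
      let ?v = "r - a"
      let ?t = "e \<bullet> ?v / norm ?v"
      have "?t \<le> s k"
        unfolding s_def using r False by (intro cSup_upper bdd) (auto simp: V_def)
      \<comment> \<open>One \<open>1 / N\<close> comes from the gap between consecutive wedges, the
        other from the choice of \<open>\<xi>\<close>.\<close>
      then have "?t \<le> \<xi> + 2 / N" using gap \<xi> by (simp add: field_simps)
      moreover have "2 / N \<le> \<kappa>\<^sup>2 / 8"
        using N \<kappa> Npos by (simp add: field_simps)
      moreover have "0 \<le> p z" "0 \<le> p ?v"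
        using d_nonneg[of q] d_nonneg[of r] sub q r by (auto simp: p_def z_def)
      moreover have "(p z)\<^sup>2 + \<xi>\<^sup>2 = 1" "(p ?v)\<^sup>2 + ?t\<^sup>2 = 1"
        using unit[OF z0] unit[of ?v] False \<xi>z by simp_all
      ultimately have "p z * ?t - \<xi> * p ?v \<le> \<kappa>"
        using \<xi>(2) \<kappa> less_imp_le cross_le_of_near_extreme[of "p z" "p ?v" \<xi> ?t "2 / N" \<kappa>]
        by blast
      then have "(p z * ?t - \<xi> * p ?v) * norm ?v \<le> \<kappa> * norm ?v"
        by (intro mult_right_mono) auto
      moreover have "(p z * ?t - \<xi> * p ?v) * norm ?v = \<nu> \<bullet> ?v"
        using False by (simp add: \<nu>_def p_def[of ?v] inner_diff_left left_diff_distrib)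
      ultimately show ?thesis by simp
    qed simp
  qed
qed

end

section \<open>Egalitarian cost and the impossibility\<close>

lemma dist_le_egal_cost: "p \<in> set xs \<Longrightarrow> dist p y \<le> egal_cost y xs"
  unfolding egal_cost_def by (auto simp: in_set_conv_nth intro!: Max_ge)

lemma egal_cost_le: "xs \<noteq> [] \<Longrightarrow> (\<And>p. p \<in> set xs \<Longrightarrow> dist p y \<le> \<rho>) \<Longrightarrow> egal_cost y xs \<le> \<rho>"
  unfolding egal_cost_def by (intro Max.boundedI) (auto simp: lessThan_empty_iff)

lemma egal_cost_nonneg: "xs \<noteq> [] \<Longrightarrow> 0 \<le> egal_cost y xs"
  using dist_le_egal_cost[of "hd xs" xs y] zero_le_dist[of "hd xs" y] by (simp del: zero_le_dist)

theorem theorem4: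
  fixes \<delta> :: real
  assumes "\<delta> > 0"
  shows "\<not> (\<exists>f :: mechanism. unanimous f \<and> anonymous f \<and> scale_independent f \<and> truthful f \<and>
           consistent (2 - \<delta>) f \<and> robust (1 + sqrt 2 - \<delta>) f)"
proof (intro notI, elim exE conjE)
  fix f :: mechanism
  assume f: "unanimous f" "anonymous f" "truthful f" "consistent (2 - \<delta>) f" "robust (1 + sqrt 2 - \<delta>) f"
  \<comment> \<open>Capping \<open>\<delta>\<close> at 1 keeps \<open>\<beta>\<close>
    positive.\<close>
  define \<beta> where "\<beta> = 1 + sqrt 2 - min \<delta> 1"
  define c :: real where "c = 1 - sqrt (1/2)"
  have "0 < sqrt 2" by simp
  then have \<beta>: "0 < \<beta>" "\<beta> < 1 + sqrt 2" using assms unfolding \<beta>_def by linarith+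
  \<comment> \<open>The number of agents depends on \<open>\<theta>\<close> but
    \<open>\<beta>\<close> does not, so \<open>\<theta>\<close> can tend to 0 afterwards.\<close>
  have bound: "1/2 - 6 * \<theta> \<le> (\<beta> * (c + 3 * \<theta>))\<^sup>2" if \<theta>: "0 < \<theta>" "\<theta> \<le> 1" for \<theta>
  proof -
    define \<sigma> where "\<sigma> = \<theta>\<^sup>2 / 14"
    define \<tau> where "\<tau> = \<sigma>\<^sup>2 / 24"
    define \<kappa> where "\<kappa> = \<tau>\<^sup>2 / 6"
    have "0 < \<sigma>" "\<sigma> \<le> 1" using \<theta> power_le_one[of \<theta> 2] by (simp_all add: \<sigma>_def)
    then have "0 < \<tau>" "\<tau> \<le> 1" using power_le_one[of \<sigma> 2] by (simp_all add: \<tau>_def)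
    then have \<kappa>: "0 < \<kappa>" "\<kappa> \<le> 1" using power_le_one[of \<tau> 2] by (simp_all add: \<kappa>_def)
    obtain N :: nat where N: "16 / \<kappa>\<^sup>2 \<le> N" using real_arch_simple by blast
    define n where "n = 2 * N + 2"
    define b :: point where "b = 2 *\<^sub>R axis 1 1"
    define ps where "ps = replicate (n - 1) 0 @ [b]"
    \<comment> \<open>By anonymity the choice of the list does not matter for multisets of size
      \<open>n\<close>.\<close>
    define G where "G X = f (SOME xs. mset xs = X) ps" for X
    have ps: "length ps = n" "1 \<le> n" by (auto simp: ps_def n_def)
    have G: "G (mset xs) = f xs ps" if len: "length xs = n" for xs
    proof -
      have "mset (SOME ys. mset ys = mset xs) = mset xs" by (rule someI) simp
      then obtain \<pi> where "\<pi> permutes {..<length xs}" "permute_list \<pi> xs = (SOME ys. mset ys = mset xs)"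
        by (rule mset_eq_permutation)
      then show ?thesis
        using f(2) len ps unfolding anonymous_def instance_ok_def G_def by metis
    qed
    interpret planar_rule G n
    proof
      show "G (replicate_mset n p) = p" for p
        using G[of "replicate n p"] f(1) ps by (simp add: unanimous_def instance_ok_def)
      fix x x' :: point and X :: "point multiset" assume "size X + 1 = n"
      moreover obtain xs where "mset xs = X" using ex_mset by blast
      ultimately have "G (add_mset x X) = f (x # xs) ps" "G (add_mset x' X) = f ((x # xs)[0 := x']) ps"
        "instance_ok (x # xs) ps"
        using G[of "x # xs"] G[of "x' # xs"] ps by (auto simp: instance_ok_def)
      then show "dist x (G (add_mset x X)) \<le> dist x (G (add_mset x' X))"
        using f(3) unfolding truthful_def by (metis length_greater_0_conv list.distinct(1) nth_Cons_0)
    qed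
    have cost: "dist p (G X) \<le> \<beta> * \<rho>"
      if "size X = n" and ball: "\<And>p. p \<in># X \<Longrightarrow> dist p y \<le> \<rho>" and p: "p \<in># X" for X y \<rho> p
    proof -
      obtain xs where xs: "mset xs = X" using ex_mset by blast
      then have len: "length xs = n" using that(1) by auto
      then have ne: "xs \<noteq> []" using ps by auto
      let ?opt = "egal_cost (opt_loc xs) xs"
      have opt: "0 \<le> ?opt" "?opt \<le> \<rho>"
        using egal_cost_nonneg[OF ne] egal_cost_opt_loc_le[OF ne, of y] egal_cost_le[OF ne, of y \<rho>] ball xs
        by auto
      have "dist p (G X) \<le> egal_cost (f xs ps) xs"
        using G[OF len] xs p dist_le_egal_cost by auto
      also have "\<dots> \<le> (1 + sqrt 2 - \<delta>) * ?opt"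
        using f(5) len ps by (simp add: robust_def instance_ok_def)
      also have "\<dots> \<le> \<beta> * ?opt" using opt by (intro mult_right_mono) (auto simp: \<beta>_def)
      also have "\<dots> \<le> \<beta> * \<rho>" using opt \<beta> by (intro mult_left_mono) auto
      finally show ?thesis .
    qed
    define q where "q = two_cluster (n - 1) 0 b"
    have "q \<in> option_set (n - 1) 0" unfolding q_def by (rule two_cluster_in_option_set) simp
    \<comment> \<open>On the accurate profile \<open>ps\<close> the outcome 0 costs 2, while the
      midpoint \<open>b /\<^sub>R 2\<close> costs at most 1, so consistency below 2 excludes
      it.\<close>
    moreover have "q \<noteq> 0"
    proof
      assume q0: "q = 0"
      have "q = G (mset ps)" using ps by (simp add: q_def two_cluster_def ps_def)
      then have f0: "f ps ps = 0" using G[OF ps(1)] q0 by simp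
      have ne: "ps \<noteq> []" by (simp add: ps_def)
      let ?opt = "egal_cost (opt_loc ps) ps"
      have nb: "norm b = 2" by (simp add: b_def)
      have "dist b (0::point) = 2" "dist 0 (b /\<^sub>R 2) = 1" "dist b (b /\<^sub>R 2) = 1"
        using nb by (simp_all add: dist_norm b_def scaleR_2)
      moreover from this have "dist p (b /\<^sub>R 2) \<le> 1" if "p \<in> set ps" for p
        using that by (auto simp: ps_def split: if_splits)
      ultimately have b: "2 \<le> egal_cost 0 ps" "egal_cost (b /\<^sub>R 2) ps \<le> 1"
        using dist_le_egal_cost[of b ps 0] egal_cost_le[OF ne, of "b /\<^sub>R 2" 1]
        by (simp_all add: ps_def)
      then have opt: "0 \<le> ?opt" "?opt \<le> 1"
        using egal_cost_nonneg[OF ne] egal_cost_opt_loc_le[OF ne, of "b /\<^sub>R 2"] by auto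
      have "2 \<le> (2 - \<delta>) * ?opt"
        using f(4) f0 b ps unfolding consistent_def accurate_def instance_ok_def
        by (metis order_trans)
      also have "\<dots> = 2 * ?opt - \<delta> * ?opt" by (simp add: algebra_simps)
      finally have "2 * (1 - ?opt) + \<delta> * ?opt \<le> 0" by simp
      moreover have "0 \<le> \<delta> * ?opt" using assms opt by simp
      ultimately have "?opt = 1" "\<delta> * ?opt \<le> 0" using opt by auto
      then show False using assms by simp
    qed
    ultimately obtain k z \<nu> where *: "Suc k \<le> n" "0 + z \<in> option_set (Suc k) 0" "z \<noteq> 0"
      "norm \<nu> = 1" "\<nu> \<bullet> z = 0" "\<And>r. r \<in> option_set k 0 \<Longrightarrow> \<nu> \<bullet> (r - 0) \<le> \<kappa> * norm (r - 0)"
      using near_extreme_option[OF n_def N \<kappa>] by blast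
    show ?thesis unfolding c_def
    proof (rule ratio_bound[OF *])
      show "6 * \<kappa> \<le> \<tau>\<^sup>2" "24 * \<tau> \<le> \<sigma>\<^sup>2" "14 * \<sigma> \<le> \<theta>\<^sup>2" by (simp_all add: \<kappa>_def \<tau>_def \<sigma>_def)
      show "dist p (G X) \<le> \<beta> * \<rho>"
        if "size X = n" "\<And>p. p \<in># X \<Longrightarrow> dist p y \<le> \<rho>" "p \<in># X" for X y \<rho> p
        using that by (rule cost)
    qed (use \<theta> \<kappa> \<open>0 < \<tau>\<close> \<open>0 < \<sigma>\<close> in auto)
  qed
  have "((\<lambda>\<theta>::real. 1/2 - 6 * \<theta>) \<longlongrightarrow> 1/2 - 6 * 0) (at_right 0)"
    by (intro tendsto_intros)
  moreover have "((\<lambda>\<theta>. (\<beta> * (c + 3 * \<theta>))\<^sup>2) \<longlongrightarrow> (\<beta> * (c + 3 * 0))\<^sup>2) (at_right 0)"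
    by (intro tendsto_intros)
  moreover have "\<forall>\<^sub>F \<theta> in at_right 0. 1/2 - 6 * \<theta> \<le> (\<beta> * (c + 3 * \<theta>))\<^sup>2"
    using eventually_at_right_real[of 0 1] by (auto elim!: eventually_mono intro!: bound)
  ultimately have "1/2 - 6 * 0 \<le> (\<beta> * (c + 3 * 0))\<^sup>2"
    by (intro tendsto_le[of "at_right (0::real)"]) auto
  then have ge: "1/2 \<le> (\<beta> * c)\<^sup>2" by simp
  have "sqrt (1/2) < 1" by simp
  then have c: "0 < c" by (simp add: c_def)
  \<comment> \<open>In units of \<open>L\<close>, \<open>sqrt (1/2)\<close> is the limiting distance
    of the midpoint agent from the outcome and \<open>c\<close> the radius of the disc; their ratio
    is the robustness threshold.\<close>
  have "(1 + sqrt 2) * c = sqrt (1/2)"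
    by (simp add: c_def real_sqrt_divide field_simps)
  then have "\<beta> * c < sqrt (1/2)" using \<beta> c by (metis mult_strict_right_mono)
  then have "(\<beta> * c)\<^sup>2 < (sqrt (1/2))\<^sup>2" using \<beta> c by (intro power_strict_mono) auto
  with ge show False by simp
qed

end
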